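(* Let $k$ be a positive integer, let $n\geq 2k$, let $P=\{p_1,\ldots,p_n\}$ be a set of $n$ points on the real line, and let $\mathcal{B}$ be a set of bicolorings of $P$ such that each bicoloring in $\mathcal{B}$ contains more than $\left\lfloor\frac{n}{2k}+1\right\rfloor(k-1)$ red points and more than $\left\lfloor\frac{n}{2k}+1\right\rfloor(k-1)$ blue points. Then there exists a geometric system of unbiased representatives (G-SUR) for $\mathcal{B}$ consisting of intervals of size $2k$.
   Context: The points of $P$ are distinct. A bicoloring of $P$ is a map $B:P\to\{\text{Red},\text{Blue}\}$ that colors at least one point red and at least one point blue. The size of an interval is the number of points of $P$ it contains, so an interval of size $2k$ contains exactly $2k$ points of $P$. An interval is balanced with respect to $B$ if it contains the same number of red and blue points of $P$ with respect to $B$. A G-SUR for $\mathcal{B}$ consisting of intervals of size $2k$ is a family of intervals of size $2k$ such that for every $B\in\mathcal{B}$ at least one interval of the family is balanced with respect to $B$. *)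

theory Defs
  imports "HOL-Analysis.Analysis"
begin

datatype color = Red | Blue

text \<open>Extensional functions, so that colorings of \<open>P\<close> correspond exactly to maps defined on \<open>P\<close>.\<close>

definition bicoloring :: "real set \<Rightarrow> (real \<Rightarrow> color) \<Rightarrow> bool" where
  "bicoloring P B \<longleftrightarrow> B \<in> P \<rightarrow>\<^sub>E UNIV \<and> (\<exists>p\<in>P. B p = Red) \<and> (\<exists>p\<in>P. B p = Blue)"

definition interval_size :: "real set \<Rightarrow> real set \<Rightarrow> nat" where
  "interval_size P I = card (P \<inter> I)"

definition balanced :: "real set \<Rightarrow> (real \<Rightarrow> color) \<Rightarrow> real set \<Rightarrow> bool" where
  "balanced P B I \<longleftrightarrow> card {p \<in> P \<inter> I. B p = Red} = card {p \<in> P \<inter> I. B p = Blue}"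

text \<open>\<open>gsur P m BB F\<close>: the family \<open>F\<close> is a geometric system of unbiased representatives for the
  set \<open>BB\<close> of bicolorings of \<open>P\<close>, consisting of intervals of size \<open>m\<close>.\<close>

definition gsur :: "real set \<Rightarrow> nat \<Rightarrow> (real \<Rightarrow> color) set \<Rightarrow> real set set \<Rightarrow> bool" where
  "gsur P m BB F \<longleftrightarrow>
     (\<forall>I\<in>F. is_interval I \<and> interval_size P I = m) \<and>
     (\<forall>B\<in>BB. \<exists>I\<in>F. balanced P B I)"

end

theory Submission imports Defs begin

text \<open>
  Take all intervals of size \<open>2k\<close>. Fix a bicoloring and slide a window over \<open>2k\<close> consecutive
  points. If every window had at most \<open>k - 1\<close> points of one color, then covering \<open>P\<close> with
  \<open>\<lfloor>n / 2k\<rfloor> + 1\<close> windows would contradict the lower bound for that color. So some window has at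
  least \<open>k\<close> red points and some window has at most \<open>k\<close>. Since the number of red points changes by
  at most one when the window moves by one point, some window in between has exactly \<open>k\<close>.
\<close>

text \<open>A union bound: \<open>n div m\<close> consecutive blocks of length \<open>m\<close> and
  one more window, flush with the right end, cover all indices below \<open>n\<close>, and each
  holds at most \<open>b\<close> hits.\<close>

lemma card_le_by_windows:
  fixes m n b :: nat and R :: "nat \<Rightarrow> bool"
  assumes "m > 0" "m \<le> n"
    and bound: "\<And>i. i + m \<le> n \<Longrightarrow> card {j \<in> {i..<i + m}. R j} \<le> b"
  shows "card {j \<in> {..<n}. R j} \<le> (n div m + 1) * b"
proof -
  \<comment> \<open>The start \<open>n - m\<close> belongs to the flush window. It may overlap or
    equal the last block, which does no harm to an upper bound.\<close>
  define S where "S = insert (n - m) ((\<lambda>t. t * m) ` {..<n div m})"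
  have finS: "finite S"
    by (simp add: S_def)
  have "card S \<le> Suc (card ((\<lambda>t. t * m) ` {..<n div m}))"
    unfolding S_def by (simp add: card_insert_if)
  also have "\<dots> \<le> n div m + 1"
    using card_image_le[of "{..<n div m}" "\<lambda>t. t * m"] by simp
  finally have cardS: "card S \<le> n div m + 1" .
  have inside: "s + m \<le> n" if s: "s \<in> S" for s
  proof -
    have "t * m + m \<le> n" if "t < n div m" for t
    proof -
      have "Suc t * m \<le> n div m * m"
        using that by (intro mult_le_mono1) simp
      also have "\<dots> \<le> n"
        by simp
      finally show ?thesis
        by simp
    qed
    then show ?thesis
      using s \<open>m \<le> n\<close> by (auto simp: S_def)
  qed
  have "\<exists>s\<in>S. j \<in> {s..<s + m}" if "j < n" for j
  proof (cases "j div m < n div m")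
    case True
    have "j div m * m \<le> j" "j < j div m * m + m"
      using dividend_less_div_times[OF \<open>m > 0\<close>, of j] by (simp_all add: add.commute)
    with True show ?thesis
      by (intro bexI[of _ "j div m * m"]) (auto simp: S_def)
  next
    case False
    then have "n div m * m \<le> j div m * m"
      by simp
    also have "\<dots> \<le> j"
      by simp
    \<comment> \<open>The remainder of \<open>n\<close> modulo \<open>m\<close> is less than
      \<open>m\<close>, so an index past the last full block lies in the flush window.\<close>
    finally have "n - m \<le> j"
      using dividend_less_div_times[OF \<open>m > 0\<close>, of n] by simp
    then show ?thesis
      using that \<open>m \<le> n\<close> by (intro bexI[of _ "n - m"]) (auto simp: S_def)
  qed
  then have "{j \<in> {..<n}. R j} \<subseteq> (\<Union>s\<in>S. {j \<in> {s..<s + m}. R j})"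
    by fastforce
  then have "card {j \<in> {..<n}. R j} \<le> card (\<Union>s\<in>S. {j \<in> {s..<s + m}. R j})"
    using finS by (intro card_mono) auto
  also have "\<dots> \<le> (\<Sum>s\<in>S. card {j \<in> {s..<s + m}. R j})"
    by (rule card_UN_le[OF finS])
  also have "\<dots> \<le> card S * b"
    using sum_bounded_above[of S "\<lambda>s. card {j \<in> {s..<s + m}. R j}" b] bound inside by simp
  also have "\<dots> \<le> (n div m + 1) * b"
    using cardS by (rule mult_le_mono1)
  finally show ?thesis .
qed

text \<open>The two places may come in either order. If the large value comes first, negating
  \<open>f\<close> restores a rise from left to right.\<close>

lemma discrete_intermediate_value:
  fixes f :: "nat \<Rightarrow> int"
  assumes step: "\<And>i. \<bar>f (Suc i) - f i\<bar> \<le> 1"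
    and "f i \<le> c" "c \<le> f j" "i \<le> N" "j \<le> N"
  shows "\<exists>l\<le>N. f l = c"
proof (cases "i \<le> j")
  case True
  then show ?thesis
    using nat_intermed_int_val[of i j f c] assms by (meson order_trans)
next
  case False
  have "\<bar>(- f (Suc l)) - (- f l)\<bar> \<le> 1" for l
    using step[of l] by linarith
  then show ?thesis
    using nat_intermed_int_val[of j i "\<lambda>l. - f l" "- c"] assms False
    by (auto intro: order_trans)
qed

text \<open>The shift drops index \<open>i\<close> and gains index \<open>i + m\<close>, so the
  count changes by a difference of two 0/1 values. For \<open>m = 0\<close> both windows are
  empty.\<close>

lemma window_count_step:
  fixes R :: "nat \<Rightarrow> bool"
  shows "\<bar>int (card {j \<in> {Suc i..<Suc i + m}. R j}) - int (card {j \<in> {i..<i + m}. R j})\<bar> \<le> 1"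
proof -
  have count: "card {j \<in> {a..<b}. R j} = (\<Sum>j\<in>{a..<b}. if R j then 1 else 0)" for a b
    by (simp add: sum.If_cases Int_def)
  show ?thesis
  proof (cases m)
    case (Suc l)
    have "sum f {Suc i..<Suc i + m} = sum f {Suc i..<i + m} + f (i + m)"
      and "sum f {i..<i + m} = f i + sum f {Suc i..<i + m}" for f :: "nat \<Rightarrow> nat"
      using Suc by (simp_all add: sum.atLeast_Suc_lessThan)
    then show ?thesis
      unfolding count by simp
  qed simp
qed

lemma equal_window_exists:
  fixes c :: "nat \<Rightarrow> color"
  assumes "k \<ge> 1" "2 * k \<le> n"
    and red: "card {j \<in> {..<n}. c j = Red} > (n div (2 * k) + 1) * (k - 1)"
    and blue: "card {j \<in> {..<n}. c j = Blue} > (n div (2 * k) + 1) * (k - 1)"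
  obtains i where "i + 2 * k \<le> n"
    "card {j \<in> {i..<i + 2 * k}. c j = Red} = card {j \<in> {i..<i + 2 * k}. c j = Blue}"
proof -
  define w where "w x i = card {j \<in> {i..<i + 2 * k}. c j = x}" for x i
  have big: "\<exists>i\<le>n - 2 * k. k \<le> w x i"
    if "card {j \<in> {..<n}. c j = x} > (n div (2 * k) + 1) * (k - 1)" for x
  proof (rule ccontr)
    assume small: "\<not> ?thesis"
    have "w x i \<le> k - 1" if "i + 2 * k \<le> n" for i
    proof -
      have "i \<le> n - 2 * k"
        using that by linarith
      with small have "w x i < k"
        by (meson not_le)
      then show ?thesis
        by linarith
    qed
    then show False
      using card_le_by_windows[of "2 * k" n "\<lambda>j. c j = x" "k - 1"] assms(1,2) that
      by (simp add: w_def)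
  qed
  have total: "w Red i + w Blue i = 2 * k" for i
  proof -
    have "w Red i + w Blue i
        = card ({j \<in> {i..<i + 2 * k}. c j = Red} \<union> {j \<in> {i..<i + 2 * k}. c j = Blue})"
      unfolding w_def by (subst card_Un_disjoint) auto
    also have "{j \<in> {i..<i + 2 * k}. c j = Red} \<union> {j \<in> {i..<i + 2 * k}. c j = Blue}
        = {i..<i + 2 * k}"
      using color.exhaust by blast
    finally show ?thesis
      by simp
  qed
  obtain i where i: "i \<le> n - 2 * k" "k \<le> w Red i"
    using big[OF red] by blast
  obtain j where j: "j \<le> n - 2 * k" "k \<le> w Blue j"
    using big[OF blue] by blast
  have "\<bar>int (w Red (Suc l)) - int (w Red l)\<bar> \<le> 1" for l
    unfolding w_def by (rule window_count_step)
  \<comment> \<open>A window with at least \<open>k\<close> blue indices has at most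
    \<open>k\<close> red ones by \<open>total\<close>, so \<open>j\<close> gives the low end and
    \<open>i\<close> the high end. The bound \<open>n - 2 * k\<close> is the last start whose window
    stays below \<open>n\<close>.\<close>
  then obtain l where l: "l \<le> n - 2 * k" "int (w Red l) = int k"
    using discrete_intermediate_value[of "\<lambda>l. int (w Red l)" j "int k" i "n - 2 * k"] i j total[of j]
    by auto
  show thesis
  proof (rule that)
    show "l + 2 * k \<le> n"
      using l(1) assms(2) by linarith
    show "card {j \<in> {l..<l + 2 * k}. c j = Red} = card {j \<in> {l..<l + 2 * k}. c j = Blue}"
      using l(2) total[of l] by (simp add: w_def)
  qed
qed

lemma floor_divide_add_one: "\<lfloor>real n / (2 * real k) + 1\<rfloor> = int (n div (2 * k) + 1)"
  using floor_divide_of_nat_eq[of n "2 * k", where ?'a = real] by simp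

text \<open>Listing \<open>P\<close> in increasing order is an injective, order-preserving map from
  indices to points. It keeps color counts and turns windows of consecutive indices into the traces
  of intervals on \<open>P\<close>.\<close>

lemma balanced_interval_exists:
  fixes P :: "real set"
  assumes "k \<ge> 1" "2 * k \<le> card P" "finite P"
    and red: "card {p \<in> P. B p = Red} > (card P div (2 * k) + 1) * (k - 1)"
    and blue: "card {p \<in> P. B p = Blue} > (card P div (2 * k) + 1) * (k - 1)"
  obtains I where "is_interval I" "interval_size P I = 2 * k" "balanced P B I"
proof -
  define xs where "xs = sorted_list_of_set P"
  have mono: "strict_mono_on {..<card P} ((!) xs)"
    using assms(3) by (auto simp: xs_def strict_mono_on_def intro!: sorted_wrt_nth_less[of "(<)"])
  have inj: "inj_on ((!) xs) {..<card P}"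
    using mono by (rule strict_mono_on_imp_inj_on)
  have P: "P = (!) xs ` {..<card P}"
    using assms(3) nth_image[of "length xs" xs] by (simp add: xs_def lessThan_atLeast0)
  have card_nth: "card {p \<in> (!) xs ` J. B p = x} = card {j \<in> J. B (xs ! j) = x}"
    if "J \<subseteq> {..<card P}" for J x
  proof -
    have "{p \<in> (!) xs ` J. B p = x} = (!) xs ` {j \<in> J. B (xs ! j) = x}"
      by auto
    moreover have "inj_on ((!) xs) {j \<in> J. B (xs ! j) = x}"
      using inj that by (auto intro: inj_on_subset)
    ultimately show ?thesis
      by (simp add: card_image)
  qed
  have count: "card {p \<in> P. B p = x} = card {j \<in> {..<card P}. B (xs ! j) = x}" for x
    using card_nth[of "{..<card P}" x] P by simp
  obtain i where i: "i + 2 * k \<le> card P"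
    "card {j \<in> {i..<i + 2 * k}. B (xs ! j) = Red} = card {j \<in> {i..<i + 2 * k}. B (xs ! j) = Blue}"
    using equal_window_exists[OF assms(1,2) red[unfolded count] blue[unfolded count]] .
  \<comment> \<open>The closed interval from the first to the last point of the window. The index
    window is half open, hence the \<open>- 1\<close>; since \<open>k\<close> is positive, that last
    index does lie in the window.\<close>
  define I where "I = {xs ! i..xs ! (i + 2 * k - 1)}"
  have sub: "{i..<i + 2 * k} \<subseteq> {..<card P}"
    using i(1) by auto
  have "xs ! j \<in> I \<longleftrightarrow> j \<in> {i..<i + 2 * k}" if "j < card P" for j
  proof -
    have "xs ! i \<le> xs ! j \<longleftrightarrow> i \<le> j" "xs ! j \<le> xs ! (i + 2 * k - 1) \<longleftrightarrow> j \<le> i + 2 * k - 1"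
      using strict_mono_on_less_eq[OF mono] that i(1) assms(1) by simp_all
    then show ?thesis
      using assms(1) by (auto simp: I_def)
  qed
  then have PI: "P \<inter> I = (!) xs ` {i..<i + 2 * k}"
    using sub by (subst P) (auto simp del: atLeastLessThan_iff)
  show thesis
  proof (rule that)
    show "is_interval I"
      by (simp add: I_def is_interval_cc)
    show "interval_size P I = 2 * k"
      unfolding interval_size_def PI using inj sub by (simp add: card_image inj_on_subset)
    show "balanced P B I"
      unfolding balanced_def PI using i(2) by (simp add: card_nth[OF sub])
  qed
qed

theorem theorem2:
  fixes k n :: nat and P :: "real set" and BB :: "(real \<Rightarrow> color) set"
  assumes "k \<ge> 1" and "n \<ge> 2 * k"
    and "finite P" and "card P = n"
    and "\<And>B. B \<in> BB \<Longrightarrow> bicoloring P B"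
    and "\<And>B. B \<in> BB \<Longrightarrow>
      int (card {p \<in> P. B p = Red}) > \<lfloor>real n / (2 * real k) + 1\<rfloor> * (int k - 1)"
    and "\<And>B. B \<in> BB \<Longrightarrow>
      int (card {p \<in> P. B p = Blue}) > \<lfloor>real n / (2 * real k) + 1\<rfloor> * (int k - 1)"
  shows "\<exists>F. gsur P (2 * k) BB F"
proof -
  \<comment> \<open>Passes from the real floor and integer subtraction to natural numbers;
    \<open>k - 1\<close> is not truncated because \<open>k\<close> is positive.\<close>
  have bound: "\<lfloor>real n / (2 * real k) + 1\<rfloor> * (int k - 1) = int ((card P div (2 * k) + 1) * (k - 1))"
    unfolding floor_divide_add_one of_nat_mult using assms(1,4) by (simp add: of_nat_diff)
  have "\<exists>I. is_interval I \<and> interval_size P I = 2 * k \<and> balanced P B I" if "B \<in> BB" for B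
    using balanced_interval_exists[of k P B] assms(1-4) assms(6,7)[OF that, unfolded bound of_nat_less_iff]
    by metis
  then have "gsur P (2 * k) BB {I. is_interval I \<and> interval_size P I = 2 * k}"
    unfolding gsur_def by blast
  then show ?thesis ..
qed

end
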